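(* Let $K\ge1$ and let $f\in\mathcal{S}_H^{0}$ be a $K$-quasiconformal harmonic mapping from $\mathbb{D}$ onto a bounded Pommerenke interior domain $G$ (with respect to $f$). If $G$ is a radial John disk (with respect to $f$), then $\|D_f\|\in H^1_g(\mathbb{D})$.
   Context: $\mathbb{D}$ is the open unit disk in $\mathbb{C}$ and $\mathbb{D}_r=\{z:|z|<r\}$. A harmonic mapping in $\mathbb{D}$ is a complex-valued function whose real and imaginary parts are real harmonic; it can be written $f=h+\overline{g}$ with $h,g$ analytic, unique with $g(0)=0$. $\mathcal{S}_H$ is the family of sense-preserving univalent harmonic mappings $f=h+\overline{g}$ in $\mathbb{D}$ with $h(0)=g(0)=0$, $h'(0)=1$; $\mathcal{S}_H^{0}$ is the subfamily with $g'(0)=0$. $\|D_f\|=|f_z|+|f_{\overline z}|$, $l(D_f)=\big||f_z|-|f_{\overline z}|\big|$, where $f_z=\frac12(f_x-if_y)$, $f_{\overline z}=\frac12(f_x+if_y)$; $\det D_f=|f_z|^2-|f_{\overline z}|^2$. For $K\ge1$, a sense-preserving homeomorphism $f$ of a domain $\Omega_0$ onto a domain $\Omega_0'$, in the Sobolev class $W^{1,2}_{loc}(\Omega_0)$, is $K$-quasiconformal if $\|D_f(z)\|^2\le K\det D_f(z)$, i.e. $\|D_f(z)\|\le K\,l(D_f(z))$, for $z\in\Omega_0$. Radial John disk: let $d_G(w)$ be the Euclidean distance from $w$ to $\partial G$. For a univalent map $f$ on $\mathbb{D}$ with bounded simply connected image $G=f(\mathbb{D})$, $G$ is a radial $c$-John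 disk ($c\ge1$), with John center $w_0=f(0)$, if for each $w_1=f(z_1)\in G$, $z_1\in\mathbb{D}$, the curve $\gamma=f([0,z_1])$ (the image of the radial segment from $0$ to $z_1$) is rectifiable and satisfies $\sigma_\ell(w)\le c\,d_G(w)$ for all $w$ on $\gamma$, where $\sigma_\ell(w)$ is the Euclidean length of the subarc $\gamma[w_1,w]$ of $\gamma$ between $w_1$ and $w$. $G$ is a radial John disk if it is a radial $c$-John disk for some $c\ge1$. Pommerenke interior domain: let $f\in\mathcal{S}_H$ be a $K$-quasiconformal harmonic mapping of $\mathbb{D}$ onto $G$. For $0<r<1$ and distinct $w_1,w_2\in f(\partial\mathbb{D}_r)$, let $\gamma_r[w_1,w_2]$ be the smaller (i.e. shorter) subarc of $f(\partial\mathbb{D}_r)$ between $w_1$ and $w_2$, let $\ell(\gamma_r[w_1,w_2])$ be its length, and let $d_{G_r}(w_1,w_2)=\inf_\Gamma\operatorname{diam}\Gamma$, where $\Gamma$ runs through all arcs from $w_1$ to $w_2$ that lie in $G_r=f(\mathbb{D}_r)$ except for their endpoints. $G$ is called a Pommerenke interior domain if $$\sup_{0<r<1}\ \sup_{w_1\ne w_2\in f(\partial\mathbb{D}_r)}\frac{\ell(\gamma_r[w_1,w_2])}{d_{G_r}(w_1,w_2)}<\infty .$$ Generalized Hardy space: $H^1_g(\mathbb{D})$ consists of all measurable $F:\mathbb{D}\to\mathbb{C}$ such that $M_1(r,F)=\frac1{2\pi}\int_0^{2\pi}|F(re^{i\theta})|\,d\theta$ exists for all $r\in(0,1)$ and $\sup_{0<r<1}M_1(r,F)<\infty$.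 *)

theory Defs
  imports "HOL-Complex_Analysis.Complex_Analysis"
begin

abbreviation unit_disk :: "complex set"  ("\<D>")
  where "\<D> \<equiv> ball 0 1"

definition partial_x :: "(complex \<Rightarrow> 'a::real_normed_vector) \<Rightarrow> complex \<Rightarrow> 'a"
  where "partial_x f z = vector_derivative (\<lambda>t. f (z + of_real t)) (at 0)"

definition partial_y :: "(complex \<Rightarrow> 'a::real_normed_vector) \<Rightarrow> complex \<Rightarrow> 'a"
  where "partial_y f z = vector_derivative (\<lambda>t. f (z + \<i> * of_real t)) (at 0)"

text \<open>\<open>C_k n S f\<close>: \<open>f\<close> is \<open>n\<close> times continuously differentiable on the open set \<open>S\<close>.\<close>

primrec C_k :: "nat \<Rightarrow> complex set \<Rightarrow> (complex \<Rightarrow> 'a::real_normed_vector) \<Rightarrow> bool"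
  where
    "C_k 0 S f \<longleftrightarrow> continuous_on S f"
  | "C_k (Suc n) S f \<longleftrightarrow> f differentiable_on S \<and> C_k n S (partial_x f) \<and> C_k n S (partial_y f)"

definition real_harmonic_on :: "complex set \<Rightarrow> (complex \<Rightarrow> real) \<Rightarrow> bool"
  where "real_harmonic_on S u \<longleftrightarrow>
    C_k 2 S u \<and>
    (\<forall>z\<in>S. partial_x (partial_x u) z + partial_y (partial_y u) z = 0)"

definition harmonic_mapping_on :: "complex set \<Rightarrow> (complex \<Rightarrow> complex) \<Rightarrow> bool"
  where "harmonic_mapping_on S f \<longleftrightarrow>
    real_harmonic_on S (\<lambda>z. Re (f z)) \<and> real_harmonic_on S (\<lambda>z. Im (f z))"

definition f_z :: "(complex \<Rightarrow> complex) \<Rightarrow> complex \<Rightarrow> complex"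
  where "f_z f z = (partial_x f z - \<i> * partial_y f z) / 2"

definition f_zbar :: "(complex \<Rightarrow> complex) \<Rightarrow> complex \<Rightarrow> complex"
  where "f_zbar f z = (partial_x f z + \<i> * partial_y f z) / 2"

definition norm_D :: "(complex \<Rightarrow> complex) \<Rightarrow> complex \<Rightarrow> real"
  where "norm_D f z = cmod (f_z f z) + cmod (f_zbar f z)"

definition det_D :: "(complex \<Rightarrow> complex) \<Rightarrow> complex \<Rightarrow> real"
  where "det_D f z = (cmod (f_z f z))\<^sup>2 - (cmod (f_zbar f z))\<^sup>2"

text \<open>
  Orientation is expressed by the local degree, so that the notion makes sense for
  homeomorphisms without any smoothness.  It is only used for continuous injective \<open>f\<close>;
  then \<open>f z\<close> does not lie on the image of the circle.
\<close>

definition sense_preserving_on :: "complex set \<Rightarrow> (complex \<Rightarrow> complex) \<Rightarrow> bool"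
  where "sense_preserving_on S f \<longleftrightarrow>
    (\<forall>z\<in>S. \<forall>r>0. cball z r \<subseteq> S \<longrightarrow> winding_number (f \<circ> circlepath z r) (f z) = 1)"

definition canonical_decomposition ::
    "(complex \<Rightarrow> complex) \<Rightarrow> (complex \<Rightarrow> complex) \<Rightarrow> (complex \<Rightarrow> complex) \<Rightarrow> bool"
  where "canonical_decomposition f h g \<longleftrightarrow>
    h holomorphic_on \<D> \<and> g holomorphic_on \<D> \<and>
    (\<forall>z\<in>\<D>. f z = h z + cnj (g z)) \<and> g 0 = 0"

definition S_H :: "(complex \<Rightarrow> complex) set"
  where "S_H = {f. harmonic_mapping_on \<D> f \<and> inj_on f \<D> \<and> sense_preserving_on \<D> f \<and>
    (\<exists>h g. canonical_decomposition f h g \<and> h 0 = 0 \<and> deriv h 0 = 1)}"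

definition S_H0 :: "(complex \<Rightarrow> complex) set"
  where "S_H0 = {f \<in> S_H. \<exists>h g. canonical_decomposition f h g \<and> deriv g 0 = 0}"

definition L2_loc :: "complex set \<Rightarrow> (complex \<Rightarrow> complex) \<Rightarrow> bool"
  where "L2_loc \<Omega> f \<longleftrightarrow>
    f \<in> borel_measurable (lebesgue_on \<Omega>) \<and>
    (\<forall>C. compact C \<and> C \<subseteq> \<Omega> \<longrightarrow> set_integrable lebesgue C (\<lambda>z. (cmod (f z))\<^sup>2))"

definition test_function :: "complex set \<Rightarrow> (complex \<Rightarrow> real) \<Rightarrow> bool"
  where "test_function \<Omega> \<phi> \<longleftrightarrow>
    (\<forall>n. C_k n UNIV \<phi>) \<and>
    compact (closure {z. \<phi> z \<noteq> 0}) \<and> closure {z. \<phi> z \<noteq> 0} \<subseteq> \<Omega>"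

text \<open>\<open>p\<close> and \<open>q\<close> are the weak partial derivatives of \<open>f\<close>.\<close>

definition W12_loc :: "complex set \<Rightarrow> (complex \<Rightarrow> complex) \<Rightarrow> bool"
  where "W12_loc \<Omega> f \<longleftrightarrow>
    L2_loc \<Omega> f \<and>
    (\<exists>p q. L2_loc \<Omega> p \<and> L2_loc \<Omega> q \<and>
      (\<forall>\<phi>. test_function \<Omega> \<phi> \<longrightarrow>
        (LINT z:\<Omega>|lebesgue. partial_x \<phi> z *\<^sub>R f z) = - (LINT z:\<Omega>|lebesgue. \<phi> z *\<^sub>R p z) \<and>
        (LINT z:\<Omega>|lebesgue. partial_y \<phi> z *\<^sub>R f z) = - (LINT z:\<Omega>|lebesgue. \<phi> z *\<^sub>R q z)))"

definition planar_domain :: "complex set \<Rightarrow> bool"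
  where "planar_domain \<Omega> \<longleftrightarrow> open \<Omega> \<and> connected \<Omega> \<and> \<Omega> \<noteq> {}"

definition quasiconformal ::
    "real \<Rightarrow> (complex \<Rightarrow> complex) \<Rightarrow> complex set \<Rightarrow> complex set \<Rightarrow> bool"
  where "quasiconformal K f \<Omega> \<Omega>' \<longleftrightarrow>
    planar_domain \<Omega> \<and> planar_domain \<Omega>' \<and>
    (\<exists>f'. homeomorphism \<Omega> \<Omega>' f f') \<and> sense_preserving_on \<Omega> f \<and> W12_loc \<Omega> f \<and>
    (\<forall>z\<in>\<Omega>. (norm_D f z)\<^sup>2 \<le> K * det_D f z)"

text \<open>
  Length of \<open>\<gamma>\<close> restricted to \<open>[a, b]\<close>: the supremum of the lengths of inscribed polygons,
  possibly infinite.
\<close>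

definition curve_length :: "(real \<Rightarrow> complex) \<Rightarrow> real \<Rightarrow> real \<Rightarrow> ennreal"
  where "curve_length \<gamma> a b =
    (SUP (n, t) \<in> {(n::nat, t). (\<forall>i\<le>n. t i \<in> {a..b}) \<and> (\<forall>i<n. t i \<le> t (Suc i))}.
      \<Sum>i<n. ennreal (dist (\<gamma> (t i)) (\<gamma> (t (Suc i)))))"

definition radial_c_john_disk :: "real \<Rightarrow> (complex \<Rightarrow> complex) \<Rightarrow> complex set \<Rightarrow> bool"
  where "radial_c_john_disk c f G \<longleftrightarrow>
    inj_on f \<D> \<and> f ` \<D> = G \<and> bounded G \<and> simply_connected G \<and>
    (\<forall>z\<^sub>1\<in>\<D>.
      let \<gamma> = (\<lambda>t. f (of_real t * z\<^sub>1)) in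
      curve_length \<gamma> 0 1 < \<infinity> \<and>
      (\<forall>t\<in>{0..1}. curve_length \<gamma> t 1 \<le> ennreal (c * infdist (\<gamma> t) (frontier G))))"

definition radial_john_disk :: "(complex \<Rightarrow> complex) \<Rightarrow> complex set \<Rightarrow> bool"
  where "radial_john_disk f G \<longleftrightarrow> (\<exists>c\<ge>1. radial_c_john_disk c f G)"

text \<open>
  The two subarcs of the Jordan curve \<open>f (\<partial>\<D>\<^sub>r)\<close> between \<open>w\<^sub>1\<close> and \<open>w\<^sub>2\<close> are the images of
  the angular intervals with end points \<open>\<alpha>\<close>, \<open>\<beta>\<close>, where \<open>f (r e\<^sup>i\<^sup>\<alpha>) = w\<^sub>1\<close>,
  \<open>f (r e\<^sup>i\<^sup>\<beta>) = w\<^sub>2\<close> and \<open>0 < \<bar>\<alpha> - \<beta>\<bar> < 2\<pi>\<close>; one of them has \<open>\<alpha> < \<beta>\<close> and the other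
  \<open>\<beta> < \<alpha>\<close>.  The infimum is therefore the smaller of two lengths.
\<close>

definition smaller_subarc_length ::
    "(complex \<Rightarrow> complex) \<Rightarrow> real \<Rightarrow> complex \<Rightarrow> complex \<Rightarrow> ennreal"
  where "smaller_subarc_length f r w\<^sub>1 w\<^sub>2 =
    (INF (\<alpha>, \<beta>) \<in> {(\<alpha>, \<beta>). f (of_real r * cis \<alpha>) = w\<^sub>1 \<and> f (of_real r * cis \<beta>) = w\<^sub>2 \<and>
                          \<bar>\<alpha> - \<beta>\<bar> < 2 * pi}.
      curve_length (\<lambda>\<theta>. f (of_real r * cis \<theta>)) (min \<alpha> \<beta>) (max \<alpha> \<beta>))"

definition inner_diameter_dist ::
    "complex set \<Rightarrow> complex \<Rightarrow> complex \<Rightarrow> ennreal"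
  where "inner_diameter_dist U w\<^sub>1 w\<^sub>2 =
    (INF \<Gamma> \<in> {\<Gamma>. arc \<Gamma> \<and> pathstart \<Gamma> = w\<^sub>1 \<and> pathfinish \<Gamma> = w\<^sub>2 \<and> \<Gamma> ` {0<..<1} \<subseteq> U}.
      ennreal (diameter (path_image \<Gamma>)))"

definition pommerenke_interior_domain :: "(complex \<Rightarrow> complex) \<Rightarrow> complex set \<Rightarrow> bool"
  where "pommerenke_interior_domain f G \<longleftrightarrow>
    f \<in> S_H \<and> (\<exists>K\<ge>1. quasiconformal K f \<D> G) \<and>
    (SUP r \<in> {0<..<1}. SUP w\<^sub>1 \<in> f ` sphere 0 r. SUP w\<^sub>2 \<in> f ` sphere 0 r - {w\<^sub>1}.
      smaller_subarc_length f r w\<^sub>1 w\<^sub>2 / inner_diameter_dist (f ` ball 0 r) w\<^sub>1 w\<^sub>2) < \<infinity>"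

definition M_1 :: "real \<Rightarrow> (complex \<Rightarrow> complex) \<Rightarrow> real"
  where "M_1 r F =
    (1 / (2 * pi)) * (LINT \<theta>:{0..2 * pi}|lebesgue. cmod (F (of_real r * cis \<theta>)))"

definition hardy_H1_g :: "(complex \<Rightarrow> complex) set"
  where "hardy_H1_g = {F.
    F \<in> borel_measurable (lebesgue_on \<D>) \<and>
    (\<forall>r\<in>{0<..<1}. set_integrable lebesgue {0..2 * pi} (\<lambda>\<theta>. cmod (F (of_real r * cis \<theta>)))) \<and>
    bdd_above ((\<lambda>r. M_1 r F) ` {0<..<1})}"

end

theory Submission
  imports Defs
begin

text \<open>
  Let \<open>\<gamma>\<^sub>r(\<theta>) = f (r e\<^sup>i\<^sup>\<theta>)\<close>, and let \<open>L\<^sub>r\<close> be the length of this closed curve.  The interior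
  condition of Pommerenke controls only the shorter of the two arcs between two points
  of \<open>\<gamma>\<^sub>r\<close>, so the points are chosen to make the two arcs equally long: then the shorter arc
  has length \<open>L\<^sub>r / 2\<close> (\<open>ex_halving_point\<close>).  On the other side of the condition, the image of
  a chord of the disk of radius \<open>r\<close> joins the two points inside \<open>f (\<D>\<^sub>r)\<close>, so their inner
  distance is at most the diameter of the bounded set \<open>G\<close> (\<open>inner_diameter_dist_le_diameter\<close>).
  Hence \<open>L\<^sub>r\<close> is bounded uniformly in \<open>r\<close>.

  Quasiconformality turns the bound on lengths into a bound on the means of \<open>\<parallel>D\<^sub>f\<parallel>\<close>: writing
  \<open>f = h + cnj g\<close>, the speed of \<open>\<gamma>\<^sub>r\<close> is at least \<open>r (\<bar>h'\<bar> - \<bar>g'\<bar>)\<close>, and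
  \<open>\<parallel>D\<^sub>f\<parallel> = \<bar>h'\<bar> + \<bar>g'\<bar> \<le> K (\<bar>h'\<bar> - \<bar>g'\<bar>)\<close> (\<open>quasiconformal_norm_le\<close>).  So \<open>r\<close> times the integral
  of \<open>\<parallel>D\<^sub>f\<parallel>\<close> over the circle is at most \<open>K L\<^sub>r\<close>.  The factor \<open>r\<close> is harmless for \<open>r > 1/2\<close>, and for
  \<open>r \<le> 1/2\<close> the continuous function \<open>\<parallel>D\<^sub>f\<parallel>\<close> is bounded by compactness.
\<close>

section \<open>Length of smooth curves\<close>

text \<open>
  Inscribed polygons of small mesh almost attain the integral of the speed: by uniform
  continuity of \<open>\<gamma>'\<close>, on a short interval both the chord and the integral of the speed
  differ from \<open>(u - s) \<bar>\<gamma>'(s)\<bar>\<close> by at most \<open>\<epsilon> (u - s)\<close>.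
\<close>

lemma curve_length_ge_integral_speed:
  fixes \<gamma> \<gamma>' :: "real \<Rightarrow> complex"
  assumes deriv: "\<And>t. t \<in> {a..b} \<Longrightarrow> (\<gamma> has_vector_derivative \<gamma>' t) (at t within {a..b})"
    and cont: "continuous_on {a..b} \<gamma>'"
    and "a \<le> b"
  shows "ennreal (integral {a..b} (\<lambda>t. cmod (\<gamma>' t))) \<le> curve_length \<gamma> a b"
proof (rule ennreal_le_epsilon)
  fix e :: real
  assume "0 < e"
  \<comment> \<open>Both errors add up to \<open>2 \<epsilon> (b - a)\<close>; the \<open>+ 1\<close> avoids division by zero when \<open>a = b\<close>.\<close>
  define \<epsilon> where "\<epsilon> = e / (2 * (b - a + 1))"
  have "\<epsilon> > 0"
    using \<open>0 < e\<close> \<open>a \<le> b\<close> by (simp add: \<epsilon>_def)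
  have \<epsilon>_total: "2 * \<epsilon> * (b - a) \<le> e"
    using \<open>0 < e\<close> \<open>a \<le> b\<close> by (simp add: \<epsilon>_def field_simps)
  have "uniformly_continuous_on {a..b} \<gamma>'"
    using cont by (rule compact_uniformly_continuous) simp
  then obtain \<delta> where "\<delta> > 0"
    and \<delta>: "\<And>s t. \<lbrakk>s \<in> {a..b}; t \<in> {a..b}; dist t s < \<delta>\<rbrakk> \<Longrightarrow> dist (\<gamma>' t) (\<gamma>' s) < \<epsilon>"
    unfolding uniformly_continuous_on_def using \<open>\<epsilon> > 0\<close> by metis
  obtain n :: nat where n: "(b - a) / \<delta> < real n"
    using reals_Archimedean2 by blast
  have "n > 0"
    using n \<open>\<delta> > 0\<close> \<open>a \<le> b\<close> by (cases n) (auto simp: field_simps)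
  define t where "t i = a + real i * ((b - a) / n)" for i :: nat
  have t_step: "t (Suc i) - t i = (b - a) / n" for i
    by (simp add: t_def algebra_simps add_divide_distrib diff_divide_distrib)
  have step_less: "(b - a) / n < \<delta>"
    using n \<open>n > 0\<close> \<open>\<delta> > 0\<close> by (simp add: field_simps)
  have t_mem: "t i \<in> {a..b}" if "i \<le> n" for i
  proof -
    have "real i * ((b - a) / n) \<le> real n * ((b - a) / n)"
      using that \<open>a \<le> b\<close> by (intro mult_right_mono) auto
    then show ?thesis
      using \<open>n > 0\<close> \<open>a \<le> b\<close> by (simp add: t_def)
  qed
  have t_mono: "t i \<le> t (Suc i)" for i
    using t_step[of i] \<open>a \<le> b\<close> by (smt (verit) divide_nonneg_nonneg of_nat_0_le_iff)
  have t_ends: "t 0 = a" "t n = b"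
    using \<open>n > 0\<close> by (auto simp: t_def)
  define Q where "Q x = integral {a..x} (\<lambda>t. cmod (\<gamma>' t))" for x
  have cont_speed: "continuous_on {a..b} (\<lambda>t. cmod (\<gamma>' t))"
    by (intro continuous_intros cont)
  have piece: "Q (t (Suc i)) - Q (t i) \<le> dist (\<gamma> (t i)) (\<gamma> (t (Suc i))) + 2 * \<epsilon> * ((b - a) / n)"
    if "i < n" for i
  proof -
    define s u where "s = t i" and "u = t (Suc i)"
    have su: "s \<in> {a..b}" "u \<in> {a..b}" "s \<le> u" "u - s = (b - a) / n"
      using t_mem[of i] t_mem[of "Suc i"] t_mono[of i] t_step[of i] that by (auto simp: s_def u_def)
    have sub: "{s..u} \<subseteq> {a..b}"
      using su by auto
    have close: "cmod (\<gamma>' x - \<gamma>' s) \<le> \<epsilon>" if "x \<in> {s..u}" for x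
    proof -
      have "dist x s < \<delta>"
        using that su step_less by (auto simp: dist_real_def)
      then show ?thesis
        using \<delta>[of s x] that sub su by (auto simp: dist_norm less_imp_le)
    qed
    have "cmod (\<gamma> u - \<gamma> s - (u - s) *\<^sub>R \<gamma>' s) \<le> norm (u - s) * \<epsilon>"
    proof (rule vector_differentiable_bound_linearization)
      show "(\<gamma> has_vector_derivative \<gamma>' x) (at x within {s..u})" if "x \<in> {s..u}" for x
        using deriv that sub has_vector_derivative_within_subset by blast
      show "closed_segment s u \<subseteq> {s..u}"
        using su by (simp add: closed_segment_eq_real_ivl)
    qed (use close su in auto)
    moreover have "(u - s) * cmod (\<gamma>' s) \<le>
        cmod (\<gamma> u - \<gamma> s) + cmod (\<gamma> u - \<gamma> s - (u - s) *\<^sub>R \<gamma>' s)"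
    proof -
      have "(u - s) * cmod (\<gamma>' s) = cmod ((\<gamma> u - \<gamma> s) - (\<gamma> u - \<gamma> s - (u - s) *\<^sub>R \<gamma>' s))"
        using \<open>s \<le> u\<close> by simp
      then show ?thesis
        using norm_triangle_ineq4[of "\<gamma> u - \<gamma> s" "\<gamma> u - \<gamma> s - (u - s) *\<^sub>R \<gamma>' s"] by linarith
    qed
    ultimately have chord: "(u - s) * cmod (\<gamma>' s) \<le> dist (\<gamma> s) (\<gamma> u) + \<epsilon> * (u - s)"
      using su by (simp add: dist_norm norm_minus_commute mult.commute)
    have "Q u = Q s + integral {s..u} (\<lambda>t. cmod (\<gamma>' t))"
      unfolding Q_def using su continuous_on_subset[OF cont_speed, of "{a..u}"]
      by (intro Henstock_Kurzweil_Integration.integral_combine[symmetric] integrable_continuous_real)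
        auto
    moreover have "integral {s..u} (\<lambda>t. cmod (\<gamma>' t)) \<le> integral {s..u} (\<lambda>t. cmod (\<gamma>' s) + \<epsilon>)"
    proof (rule integral_le)
      show "(\<lambda>t. cmod (\<gamma>' t)) integrable_on {s..u}"
        by (intro integrable_continuous_real continuous_on_subset[OF cont_speed sub])
      show "cmod (\<gamma>' x) \<le> cmod (\<gamma>' s) + \<epsilon>" if "x \<in> {s..u}" for x
        using close[OF that] norm_triangle_sub[of "\<gamma>' x" "\<gamma>' s"] by linarith
    qed auto
    moreover have "integral {s..u} (\<lambda>t. cmod (\<gamma>' s) + \<epsilon>) = (u - s) * cmod (\<gamma>' s) + \<epsilon> * (u - s)"
      using \<open>s \<le> u\<close> by (simp add: algebra_simps)
    ultimately have "Q u - Q s \<le> dist (\<gamma> s) (\<gamma> u) + 2 * \<epsilon> * (u - s)"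
      using chord by linarith
    then show ?thesis
      using su by (simp add: s_def u_def)
  qed
  have "integral {a..b} (\<lambda>t. cmod (\<gamma>' t)) = Q (t n) - Q (t 0)"
    by (simp add: t_ends Q_def)
  also have "\<dots> = (\<Sum>i<n. Q (t (Suc i)) - Q (t i))"
    by (rule sum_lessThan_telescope[symmetric])
  also have "\<dots> \<le> (\<Sum>i<n. dist (\<gamma> (t i)) (\<gamma> (t (Suc i))) + 2 * \<epsilon> * ((b - a) / n))"
    by (intro sum_mono piece) auto
  also have "\<dots> = (\<Sum>i<n. dist (\<gamma> (t i)) (\<gamma> (t (Suc i)))) + 2 * \<epsilon> * (b - a)"
    using \<open>n > 0\<close> by (simp add: sum.distrib)
  finally have "integral {a..b} (\<lambda>t. cmod (\<gamma>' t)) \<le> (\<Sum>i<n. dist (\<gamma> (t i)) (\<gamma> (t (Suc i)))) + e"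
    using \<epsilon>_total by linarith
  then have "ennreal (integral {a..b} (\<lambda>t. cmod (\<gamma>' t))) \<le>
      ennreal ((\<Sum>i<n. dist (\<gamma> (t i)) (\<gamma> (t (Suc i)))) + e)"
    by (rule ennreal_leI)
  also have "\<dots> = (\<Sum>i<n. ennreal (dist (\<gamma> (t i)) (\<gamma> (t (Suc i))))) + ennreal e"
    using \<open>0 < e\<close> by (subst ennreal_plus) (auto simp: sum_nonneg)
  also have "(\<Sum>i<n. ennreal (dist (\<gamma> (t i)) (\<gamma> (t (Suc i))))) \<le> curve_length \<gamma> a b"
    unfolding curve_length_def
    by (rule SUP_upper2[where i = "(n, t)"]) (use t_mem t_mono in auto)
  finally show "ennreal (integral {a..b} (\<lambda>t. cmod (\<gamma>' t))) \<le> curve_length \<gamma> a b + ennreal e"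
    by (simp add: add_right_mono)
qed

lemma integral_periodic_shift:
  fixes p :: "real \<Rightarrow> real"
  assumes per: "\<And>t. p (t + 2 * pi) = p t"
  shows "integral {a + 2 * pi * of_int k..b + 2 * pi * of_int k} p = integral {a..b} p"
proof -
  have nat: "p (t + 2 * pi * real n) = p t" for t n
    by (induction n) (use per[of "t + 2 * pi * real n" for n] in \<open>simp_all add: algebra_simps\<close>)
  have int: "p (t + 2 * pi * of_int k) = p t" for t
  proof (cases "k \<ge> 0")
    case True
    then show ?thesis using nat[of t "nat k"] by simp
  next
    case False
    then show ?thesis using nat[of "t + 2 * pi * of_int k" "nat (- k)"] by simp
  qed
  show ?thesis
    using integral_shift_real_ivl[of "a + 2 * pi * of_int k" "2 * pi * of_int k" "b + 2 * pi * of_int k" p]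
    by (simp add: int)
qed

lemma cis_eq_cis_iff: "cis x = cis y \<longleftrightarrow> (\<exists>n::int. x = y + 2 * pi * of_int n)"
  using sin_cos_eq_iff[of x y] by (auto simp: complex_eq_iff)

section \<open>Halving a closed curve\<close>

text \<open>
  The arc length from angle \<open>0\<close> grows continuously from \<open>0\<close> to \<open>L\<close>, so it equals \<open>L / 2\<close> at some
  angle \<open>\<theta>\<close>; the points at the angles \<open>0\<close> and \<open>\<theta>\<close> cut the curve into halves.  The infimum in
  \<open>smaller_subarc_length\<close> runs over all lifts of the two points to angles less than \<open>2 \<pi>\<close>
  apart, and up to a common shift by a multiple of \<open>2 \<pi>\<close> these bound one of the intervals
  \<open>[0, \<theta>]\<close> and \<open>[\<theta>, 2 \<pi>]\<close>.
\<close>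

lemma ex_halving_point:
  fixes f :: "complex \<Rightarrow> complex" and \<gamma>' :: "real \<Rightarrow> complex"
  defines "L \<equiv> integral {0..2 * pi} (\<lambda>t. cmod (\<gamma>' t))"
  assumes inj: "inj_on f (sphere 0 r)" and "r > 0"
    and deriv: "\<And>t. ((\<lambda>\<theta>. f (of_real r * cis \<theta>)) has_vector_derivative \<gamma>' t) (at t)"
    and cont: "continuous_on UNIV \<gamma>'"
    and per: "\<And>t. \<gamma>' (t + 2 * pi) = \<gamma>' t"
    and "L > 0"
  shows "\<exists>w\<^sub>1\<in>f ` sphere 0 r. \<exists>w\<^sub>2\<in>f ` sphere 0 r - {w\<^sub>1}.
    ennreal (L / 2) \<le> smaller_subarc_length f r w\<^sub>1 w\<^sub>2"
proof -
  define p where "p = (\<lambda>t. cmod (\<gamma>' t))"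
  have cont_p: "continuous_on S p" for S
    unfolding p_def by (intro continuous_intros continuous_on_subset[OF cont]) auto
  have "p integrable_on {0..2 * pi}"
    by (intro integrable_continuous_real cont_p)
  then have "continuous_on {0..2 * pi} (\<lambda>x. integral {0..x} p)"
    by (rule indefinite_integral_continuous_1)
  moreover have L: "L = integral {0..2 * pi} p"
    by (simp add: L_def p_def)
  ultimately obtain \<theta> where \<theta>: "0 \<le> \<theta>" "\<theta> \<le> 2 * pi" "integral {0..\<theta>} p = L / 2"
    using IVT'[of "\<lambda>x. integral {0..x} p" 0 "L / 2" "2 * pi"] \<open>L > 0\<close> by auto
  have \<theta>_int: "0 < \<theta>" "\<theta> < 2 * pi"
    using \<theta> \<open>L > 0\<close> L by (auto simp: order.order_iff_strict)
  have second_half: "integral {\<theta>..2 * pi} p = L / 2"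
    using Henstock_Kurzweil_Integration.integral_combine[of 0 \<theta> "2 * pi" p] \<theta> L
      integrable_continuous_real[OF cont_p] by fastforce
  have cis_eq: "cis x = cis y" if "f (of_real r * cis x) = f (of_real r * cis y)" for x y
    using inj_onD[OF inj that] \<open>r > 0\<close> by (simp add: norm_mult)
  have length: "ennreal (integral {a..b} p) \<le> curve_length (\<lambda>\<theta>. f (of_real r * cis \<theta>)) a b"
    if "a \<le> b" for a b
    unfolding p_def
    by (rule curve_length_ge_integral_speed)
      (use that deriv cont in \<open>auto intro: has_vector_derivative_at_within continuous_on_subset\<close>)
  have per_p: "p (t + 2 * pi) = p t" for t
    by (simp add: p_def per)
  define w\<^sub>1 w\<^sub>2 where "w\<^sub>1 = f (of_real r * cis 0)" and "w\<^sub>2 = f (of_real r * cis \<theta>)"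
  have sphere: "f (of_real r * cis x) \<in> f ` sphere 0 r" for x
    using \<open>r > 0\<close> by (auto simp: norm_mult)
  \<comment> \<open>Two lifts of the points differ by \<open>\<theta> + 2 \<pi> k\<close>, and only two of these values are admissible.\<close>
  have small: "k = 0 \<or> k = -1" if "\<bar>\<theta> + 2 * pi * of_int k\<bar> < 2 * pi" for k :: int
  proof -
    have "2 * pi * of_int k < 2 * pi * 1" "2 * pi * (- 2) < 2 * pi * of_int k"
      using that \<theta>_int by linarith+
    then have "of_int k < (1::real)" "(- 2 :: real) < of_int k"
      using mult_less_cancel_left_pos[of "2 * pi"] by (metis pi_gt_zero zero_less_mult_iff zero_less_numeral)+
    then show ?thesis by linarith
  qed
  have "w\<^sub>2 \<noteq> w\<^sub>1"
  proof
    assume "w\<^sub>2 = w\<^sub>1"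
    then obtain k :: int where k: "\<theta> = 0 + 2 * pi * of_int k"
      using cis_eq[of \<theta> 0] cis_eq_cis_iff[of \<theta> 0] by (auto simp: w\<^sub>1_def w\<^sub>2_def)
    then have "-k = 0 \<or> -k = -1"
      by (intro small) simp
    then show False
      using k \<theta>_int by auto
  qed
  have halves: "ennreal (L / 2) \<le>
      curve_length (\<lambda>\<theta>. f (of_real r * cis \<theta>)) (min \<alpha> \<beta>) (max \<alpha> \<beta>)"
    if *: "f (of_real r * cis \<alpha>) = w\<^sub>1" "f (of_real r * cis \<beta>) = w\<^sub>2" "\<bar>\<alpha> - \<beta>\<bar> < 2 * pi" for \<alpha> \<beta>
  proof -
    obtain k :: int where k: "\<alpha> = 0 + 2 * pi * of_int k"
      using cis_eq[of \<alpha> 0] cis_eq_cis_iff[of \<alpha> 0] * by (auto simp: w\<^sub>1_def)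
    obtain m :: int where m: "\<beta> = \<theta> + 2 * pi * of_int m"
      using cis_eq[of \<beta> \<theta>] cis_eq_cis_iff[of \<beta> \<theta>] * by (auto simp: w\<^sub>2_def)
    have "m - k = 0 \<or> m - k = -1"
      using * k m by (intro small) (simp add: algebra_simps)
    then consider "m = k" | "k = m + 1" by linarith
    then have "integral {min \<alpha> \<beta>..max \<alpha> \<beta>} p = L / 2"
    proof cases
      case 1
      then have "min \<alpha> \<beta> = 0 + 2 * pi * of_int k" "max \<alpha> \<beta> = \<theta> + 2 * pi * of_int k"
        using k m \<theta>_int by (auto simp: min_def max_def)
      then show ?thesis
        by (simp only: integral_periodic_shift[of p, OF per_p] \<theta>)
    next
      case 2
      then have "min \<alpha> \<beta> = \<theta> + 2 * pi * of_int m" "max \<alpha> \<beta> = 2 * pi + 2 * pi * of_int m"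
        using k m \<theta>_int by (auto simp: min_def max_def algebra_simps)
      then show ?thesis
        by (simp only: integral_periodic_shift[of p, OF per_p] second_half)
    qed
    then show ?thesis
      using length[of "min \<alpha> \<beta>" "max \<alpha> \<beta>"] by (metis max.coboundedI1 min.cobounded1)
  qed
  have "ennreal (L / 2) \<le> smaller_subarc_length f r w\<^sub>1 w\<^sub>2"
    unfolding smaller_subarc_length_def by (rule INF_greatest) (use halves in auto)
  then show ?thesis
    using sphere \<open>w\<^sub>2 \<noteq> w\<^sub>1\<close> unfolding w\<^sub>1_def w\<^sub>2_def by blast
qed

section \<open>Level curves of a bounded Pommerenke interior domain\<close>

text \<open>
  Disks are strictly convex: the chord between two points of the circle lies in the open disk
  except for its end points, so its image under the injective \<open>f\<close> is an admissible arc.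
\<close>

lemma inner_diameter_dist_le_diameter:
  fixes f :: "complex \<Rightarrow> complex"
  assumes cont: "continuous_on (cball 0 r) f" and inj: "inj_on f (cball 0 r)"
    and sub: "f ` cball 0 r \<subseteq> G" and "bounded G"
    and w: "w\<^sub>1 \<in> f ` sphere 0 r" "w\<^sub>2 \<in> f ` sphere 0 r" "w\<^sub>1 \<noteq> w\<^sub>2"
  shows "inner_diameter_dist (f ` ball 0 r) w\<^sub>1 w\<^sub>2 \<le> ennreal (diameter G)"
proof -
  obtain z\<^sub>1 z\<^sub>2 where z: "cmod z\<^sub>1 = r" "cmod z\<^sub>2 = r" "w\<^sub>1 = f z\<^sub>1" "w\<^sub>2 = f z\<^sub>2"
    using w by auto
  then have "z\<^sub>1 \<noteq> z\<^sub>2"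
    using w by auto
  define \<Gamma> where "\<Gamma> = f \<circ> linepath z\<^sub>1 z\<^sub>2"
  have seg: "closed_segment z\<^sub>1 z\<^sub>2 \<subseteq> cball 0 r"
    using z by (intro closed_segment_subset) auto
  have "arc \<Gamma>"
    unfolding \<Gamma>_def arc_def
  proof (intro conjI path_continuous_image)
    show "inj_on (f \<circ> linepath z\<^sub>1 z\<^sub>2) {0..1}"
      using seg \<open>z\<^sub>1 \<noteq> z\<^sub>2\<close> arc_linepath[of z\<^sub>1 z\<^sub>2]
      by (intro comp_inj_on inj_on_subset[OF inj])
        (auto simp: arc_def path_image_def[symmetric])
  qed (use seg in \<open>auto intro: continuous_on_subset[OF cont]\<close>)
  moreover have "\<Gamma> ` {0<..<1} \<subseteq> f ` ball 0 r"
  proof -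
    have "linepath z\<^sub>1 z\<^sub>2 x \<in> ball 0 r" if "x \<in> {0<..<1}" for x
    proof -
      have "linepath z\<^sub>1 z\<^sub>2 x \<in> open_segment z\<^sub>1 z\<^sub>2"
        using that \<open>z\<^sub>1 \<noteq> z\<^sub>2\<close> by (auto simp: linepath_def in_segment)
      moreover have "open_segment z\<^sub>1 z\<^sub>2 \<subseteq> ball 0 r"
        using dist_decreases_open_segment[of _ z\<^sub>1 z\<^sub>2 0] z by (fastforce simp: dist_commute)
      ultimately show ?thesis by blast
    qed
    then show ?thesis
      by (auto simp: \<Gamma>_def)
  qed
  ultimately have "inner_diameter_dist (f ` ball 0 r) w\<^sub>1 w\<^sub>2 \<le> ennreal (diameter (path_image \<Gamma>))"
    unfolding inner_diameter_dist_def
    by (intro INF_lower) (auto simp: \<Gamma>_def z pathstart_compose pathfinish_compose)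
  also have "path_image \<Gamma> \<subseteq> G"
    using seg sub by (auto simp: \<Gamma>_def path_image_compose)
  then have "ennreal (diameter (path_image \<Gamma>)) \<le> ennreal (diameter G)"
    using \<open>bounded G\<close> by (intro ennreal_leI diameter_subset)
  finally show ?thesis .
qed

text \<open>
  In \<open>ennreal\<close> a positive number divided by \<open>0\<close> is \<open>\<infinity>\<close>, so a finite bound on the quotient
  forces \<open>x = 0\<close> when \<open>d = 0\<close>; but \<open>x / \<infinity> = 0\<close> even for \<open>x > 0\<close>, so with \<open>S = 0\<close>
  the conclusion fails for \<open>d = \<infinity>\<close>.
\<close>

lemma ennreal_le_if_divide_le:
  fixes x d S :: ennreal
  assumes "x / d \<le> S" "S < \<infinity>" "d < \<infinity>"
  shows "x \<le> S * d"
proof (cases "d = 0")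
  case True
  then have "x = 0"
    using assms by (cases "x = 0") (auto simp: ennreal_divide_zero top_unique)
  then show ?thesis by simp
next
  case False
  then have "x = x / d * d"
    using assms by (simp add: ennreal_divide_times ennreal_divide_self)
  then show ?thesis
    using assms(1) by (metis mult_right_mono zero_le)
qed

text \<open>
  The bound depends neither on the points nor on the radius: it is the supremum in the
  interior condition times the diameter of \<open>G\<close>.
\<close>

lemma smaller_subarc_length_bounded:
  assumes pom: "pommerenke_interior_domain f G" and cont: "continuous_on \<D> f" and inj: "inj_on f \<D>"
    and img: "f ` \<D> = G" and "bounded G"
  obtains B where "\<And>r w\<^sub>1 w\<^sub>2. \<lbrakk>r \<in> {0<..<1}; w\<^sub>1 \<in> f ` sphere 0 r; w\<^sub>2 \<in> f ` sphere 0 r - {w\<^sub>1}\<rbrakk>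
    \<Longrightarrow> smaller_subarc_length f r w\<^sub>1 w\<^sub>2 \<le> ennreal B" "B \<ge> 0"
proof -
  define ratio where
    "ratio r w\<^sub>1 w\<^sub>2 = smaller_subarc_length f r w\<^sub>1 w\<^sub>2 / inner_diameter_dist (f ` ball 0 r) w\<^sub>1 w\<^sub>2"
    for r w\<^sub>1 w\<^sub>2
  define S where "S = (SUP r \<in> {0<..<1}. SUP w\<^sub>1 \<in> f ` sphere 0 r. SUP w\<^sub>2 \<in> f ` sphere 0 r - {w\<^sub>1}.
    ratio r w\<^sub>1 w\<^sub>2)"
  have "S < \<infinity>"
    using pom by (simp add: pommerenke_interior_domain_def S_def ratio_def)
  have "smaller_subarc_length f r w\<^sub>1 w\<^sub>2 \<le> S * ennreal (diameter G)"
    if "r \<in> {0<..<1}" "w\<^sub>1 \<in> f ` sphere 0 r" "w\<^sub>2 \<in> f ` sphere 0 r - {w\<^sub>1}" for r w\<^sub>1 w\<^sub>2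
  proof -
    have cball: "cball 0 r \<subseteq> \<D>"
      using that by auto
    have d: "inner_diameter_dist (f ` ball 0 r) w\<^sub>1 w\<^sub>2 \<le> ennreal (diameter G)"
    proof (rule inner_diameter_dist_le_diameter)
      show "f ` cball 0 r \<subseteq> G" using cball img by blast
    qed (use that \<open>bounded G\<close> continuous_on_subset[OF cont cball] inj_on_subset[OF inj cball] in auto)
    have "ratio r w\<^sub>1 w\<^sub>2 \<le> S"
      unfolding S_def using that by (intro SUP_upper2[OF that(1)] SUP_upper2[OF that(2)] SUP_upper)
    then have "smaller_subarc_length f r w\<^sub>1 w\<^sub>2 \<le> S * inner_diameter_dist (f ` ball 0 r) w\<^sub>1 w\<^sub>2"
      unfolding ratio_def using \<open>S < \<infinity>\<close> d
      by (intro ennreal_le_if_divide_le) (auto intro: le_less_trans)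
    also have "\<dots> \<le> S * ennreal (diameter G)"
      using d by (intro mult_left_mono) auto
    finally show ?thesis .
  qed
  moreover have "S * ennreal (diameter G) = ennreal (enn2real (S * ennreal (diameter G)))"
    using \<open>S < \<infinity>\<close> by (simp add: ennreal_mult_less_top)
  ultimately show ?thesis
    using that[of "enn2real (S * ennreal (diameter G))"] by (metis enn2real_nonneg)
qed

section \<open>Derivatives of a harmonic mapping\<close>

text \<open>
  The chain rule along a curve, applied below to coordinate lines for the Wirtinger
  derivatives and to circles for the speed of the image curve.
\<close>

lemma has_vector_derivative_canonical:
  assumes dec: "canonical_decomposition f h g"
    and \<phi>: "(\<phi> has_vector_derivative v) (at t)" and z: "\<phi> t \<in> \<D>"
  shows "((\<lambda>s. f (\<phi> s)) has_vector_derivative deriv h (\<phi> t) * v + cnj (deriv g (\<phi> t) * v)) (at t)"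
proof -
  have h: "(h has_field_derivative deriv h (\<phi> t)) (at (\<phi> t))"
    and g: "(g has_field_derivative deriv g (\<phi> t)) (at (\<phi> t))"
    using dec z by (auto simp: canonical_decomposition_def intro: holomorphic_derivI[OF _ open_ball])
  have "((\<lambda>s. h (\<phi> s) + cnj (g (\<phi> s))) has_vector_derivative
      deriv h (\<phi> t) * v + cnj (deriv g (\<phi> t) * v)) (at t)"
    using field_vector_diff_chain_at[OF \<phi> h] field_vector_diff_chain_at[OF \<phi> g]
    by (intro has_vector_derivative_add has_vector_derivative_cnj) (simp_all add: o_def mult.commute)
  moreover have "\<forall>\<^sub>F s in nhds t. \<phi> s \<in> \<D>"
  proof -
    have "isCont \<phi> t"
      using \<phi> has_vector_derivative_continuous by blast
    then have "\<forall>\<^sub>F s in at t. \<phi> s \<in> \<D>"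
      unfolding isCont_def using z open_ball topological_tendstoD by blast
    then show ?thesis
      using z by (simp add: eventually_nhds_conv_at)
  qed
  then have "\<forall>\<^sub>F s in nhds t. h (\<phi> s) + cnj (g (\<phi> s)) = f (\<phi> s)"
    by eventually_elim (use dec in \<open>auto simp: canonical_decomposition_def\<close>)
  ultimately show ?thesis
    using z dec
    by (subst (asm) has_vector_derivative_cong_ev)
      (auto simp: canonical_decomposition_def elim: eventually_mono)
qed

lemma wirtinger_canonical:
  assumes dec: "canonical_decomposition f h g" and z: "z \<in> \<D>"
  shows "f_z f z = deriv h z" and "f_zbar f z = cnj (deriv g z)"
proof -
  have "((\<lambda>t. z + of_real t) has_vector_derivative 1) (at 0)"
    by (auto intro!: derivative_eq_intros)
  from has_vector_derivative_canonical[OF dec this]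
  have x: "partial_x f z = deriv h z + cnj (deriv g z)"
    using z unfolding partial_x_def by (intro vector_derivative_at) simp
  have "((\<lambda>t. z + \<i> * of_real t) has_vector_derivative \<i>) (at 0)"
    by (auto intro!: derivative_eq_intros)
  from has_vector_derivative_canonical[OF dec this]
  have y: "partial_y f z = deriv h z * \<i> + cnj (deriv g z * \<i>)"
    using z unfolding partial_y_def by (intro vector_derivative_at) simp
  show "f_z f z = deriv h z" "f_zbar f z = cnj (deriv g z)"
    by (simp_all add: f_z_def f_zbar_def x y field_simps)
qed

text \<open>
  The inequality \<open>\<parallel>D\<^sub>f\<parallel>\<^sup>2 \<le> K det D\<^sub>f\<close> factors as \<open>(a + b)\<^sup>2 \<le> K (a + b) (a - b)\<close> with
  \<open>a = \<bar>f\<^sub>z\<bar>\<close> and \<open>b\<close> the modulus of the other derivative; a factor \<open>a + b\<close> cancels.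
\<close>

lemma quasiconformal_norm_le:
  fixes a b K :: real
  assumes "(a + b)\<^sup>2 \<le> K * (a\<^sup>2 - b\<^sup>2)" "a \<ge> 0" "b \<ge> 0"
  shows "a + b \<le> K * (a - b)"
proof (cases "a + b = 0")
  case True
  then show ?thesis using assms by (simp add: add_nonneg_eq_0_iff)
next
  case False
  have "(a + b) * (a + b) \<le> (K * (a - b)) * (a + b)"
    using assms(1) by (simp add: power2_eq_square algebra_simps)
  then show ?thesis
    using False assms by (smt (verit) mult_le_cancel_right)
qed

section \<open>Integral means of the derivative\<close>

theorem corollary1:
  fixes K :: real and f :: "complex \<Rightarrow> complex" and G :: "complex set"
  assumes "K \<ge> 1"
    and "f \<in> S_H0"
    and "quasiconformal K f \<D> G"
    and "bounded G"
    and "pommerenke_interior_domain f G"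
    and "radial_john_disk f G"
  shows "(\<lambda>z. complex_of_real (norm_D f z)) \<in> hardy_H1_g"
proof -
  obtain h g where dec: "canonical_decomposition f h g"
    using \<open>f \<in> S_H0\<close> by (auto simp: S_H0_def)
  have holo: "deriv h holomorphic_on \<D>" "deriv g holomorphic_on \<D>"
    using dec by (auto simp: canonical_decomposition_def intro: holomorphic_deriv)
  have inj: "inj_on f \<D>"
    using \<open>f \<in> S_H0\<close> by (auto simp: S_H0_def S_H_def)
  obtain f' where "homeomorphism \<D> G f f'"
    using \<open>quasiconformal K f \<D> G\<close> by (auto simp: quasiconformal_def)
  then have cont: "continuous_on \<D> f" and img: "f ` \<D> = G"
    by (auto simp: homeomorphism_def)
  have norm_D: "norm_D f z = cmod (deriv h z) + cmod (deriv g z)" if "z \<in> \<D>" for z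
    using wirtinger_canonical[OF dec that] by (simp add: norm_D_def)
  have norm_D_nonneg: "norm_D f z \<ge> 0" for z
    by (simp add: norm_D_def)
  have cont_norm: "continuous_on \<D> (norm_D f)"
    by (subst continuous_on_cong[OF refl norm_D])
      (auto intro!: continuous_intros holomorphic_on_imp_continuous_on holo)
  have dilatation: "norm_D f z \<le> K * (cmod (deriv h z) - cmod (deriv g z))" if "z \<in> \<D>" for z
  proof -
    have "(norm_D f z)\<^sup>2 \<le> K * det_D f z"
      using \<open>quasiconformal K f \<D> G\<close> that by (auto simp: quasiconformal_def)
    then show ?thesis
      using wirtinger_canonical[OF dec that] unfolding norm_D[OF that]
      by (intro quasiconformal_norm_le) (auto simp: norm_D_def det_D_def)
  qed
  have circle_in: "of_real r * cis \<theta> \<in> \<D>" if "r \<in> {0<..<1}" for r \<theta>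
    using that by (simp add: norm_mult)
  have cont_circle: "continuous_on S (\<lambda>\<theta>. F (of_real r * cis \<theta>))"
    if "r \<in> {0<..<1}" "continuous_on \<D> F" for r S and F :: "complex \<Rightarrow> 'a::topological_space"
    by (rule continuous_on_compose2[OF that(2)])
      (use circle_in[OF that(1)] in \<open>auto intro!: continuous_intros\<close>)
  have cont_norm_circle: "continuous_on S (\<lambda>\<theta>. norm_D f (of_real r * cis \<theta>))"
    if "r \<in> {0<..<1}" for r S
    using cont_circle[OF that cont_norm] .

  obtain B where "B \<ge> 0" and B: "\<And>r w\<^sub>1 w\<^sub>2.
      \<lbrakk>r \<in> {0<..<1}; w\<^sub>1 \<in> f ` sphere 0 r; w\<^sub>2 \<in> f ` sphere 0 r - {w\<^sub>1}\<rbrakk>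
      \<Longrightarrow> smaller_subarc_length f r w\<^sub>1 w\<^sub>2 \<le> ennreal B"
    using smaller_subarc_length_bounded[OF \<open>pommerenke_interior_domain f G\<close> cont inj img \<open>bounded G\<close>]
    by metis
  have mean_bound: "r * integral {0..2 * pi} (\<lambda>\<theta>. norm_D f (of_real r * cis \<theta>)) \<le> K * (2 * B)"
    if r: "r \<in> {0<..<1}" for r
  proof -
    define z where "z \<theta> = of_real r * cis \<theta>" for \<theta>
    define \<gamma>' where "\<gamma>' \<theta> = deriv h (z \<theta>) * (\<i> * z \<theta>) + cnj (deriv g (z \<theta>) * (\<i> * z \<theta>))" for \<theta>
    define L where "L = integral {0..2 * pi} (\<lambda>\<theta>. cmod (\<gamma>' \<theta>))"
    have z_in: "z \<theta> \<in> \<D>" for \<theta>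
      using circle_in[OF r] by (simp add: z_def)
    have cont': "continuous_on UNIV \<gamma>'"
      using cont_circle[OF r holomorphic_on_imp_continuous_on[OF holo(1)]]
        cont_circle[OF r holomorphic_on_imp_continuous_on[OF holo(2)]]
      unfolding \<gamma>'_def z_def by (intro continuous_intros)
    have deriv: "((\<lambda>\<theta>. f (of_real r * cis \<theta>)) has_vector_derivative \<gamma>' \<theta>) (at \<theta>)" for \<theta>
    proof -
      have "(z has_vector_derivative \<i> * z \<theta>) (at \<theta>)"
        unfolding z_def cis_conv_exp
        by (rule has_vector_derivative_real_field) (auto intro!: derivative_eq_intros)
      from has_vector_derivative_canonical[OF dec this z_in] show ?thesis
        by (simp add: z_def \<gamma>'_def)
    qed
    have speed: "r * norm_D f (z \<theta>) \<le> K * cmod (\<gamma>' \<theta>)" for \<theta>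
    proof -
      have "cmod (deriv h (z \<theta>) * (\<i> * z \<theta>)) - cmod (cnj (deriv g (z \<theta>) * (\<i> * z \<theta>))) \<le> cmod (\<gamma>' \<theta>)"
        unfolding \<gamma>'_def by (rule norm_diff_ineq)
      moreover have "cmod (z \<theta>) = r"
        using r by (simp add: z_def norm_mult)
      ultimately have "r * (cmod (deriv h (z \<theta>)) - cmod (deriv g (z \<theta>))) \<le> cmod (\<gamma>' \<theta>)"
        by (simp add: norm_mult algebra_simps)
      then have "K * (r * (cmod (deriv h (z \<theta>)) - cmod (deriv g (z \<theta>)))) \<le> K * cmod (\<gamma>' \<theta>)"
        using \<open>K \<ge> 1\<close> by (intro mult_left_mono) auto
      moreover have "r * norm_D f (z \<theta>) \<le> r * (K * (cmod (deriv h (z \<theta>)) - cmod (deriv g (z \<theta>))))"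
        using dilatation[OF z_in] r by (intro mult_left_mono) auto
      ultimately show ?thesis
        by (simp add: algebra_simps)
    qed
    have "L \<le> 2 * B"
    proof (rule ccontr)
      assume "\<not> L \<le> 2 * B"
      then have "L > 0" "L / 2 > B"
        using \<open>B \<ge> 0\<close> by auto
      moreover have "inj_on f (sphere 0 r)"
        using r by (intro inj_on_subset[OF inj]) auto
      moreover have "\<gamma>' (t + 2 * pi) = \<gamma>' t" for t
        by (simp add: \<gamma>'_def z_def flip: cis_mult)
      ultimately obtain w\<^sub>1 w\<^sub>2 where "w\<^sub>1 \<in> f ` sphere 0 r" "w\<^sub>2 \<in> f ` sphere 0 r - {w\<^sub>1}"
        "ennreal (L / 2) \<le> smaller_subarc_length f r w\<^sub>1 w\<^sub>2"
        using ex_halving_point[of f r \<gamma>'] r deriv cont' unfolding L_def by auto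
      then have "ennreal (L / 2) \<le> ennreal B"
        using B[OF r] by (meson order_trans)
      then show False
        using \<open>L / 2 > B\<close> \<open>B \<ge> 0\<close> by simp
    qed
    have "r * integral {0..2 * pi} (\<lambda>\<theta>. norm_D f (z \<theta>)) = integral {0..2 * pi} (\<lambda>\<theta>. r * norm_D f (z \<theta>))"
      by simp
    also have "\<dots> \<le> integral {0..2 * pi} (\<lambda>\<theta>. K * cmod (\<gamma>' \<theta>))"
      using speed cont_norm_circle[OF r] continuous_on_subset[OF cont'] unfolding z_def
      by (intro integral_le integrable_continuous_real continuous_intros) auto
    also have "\<dots> = K * L"
      by (simp add: L_def)
    also have "\<dots> \<le> K * (2 * B)"
      using \<open>L \<le> 2 * B\<close> \<open>K \<ge> 1\<close> by (intro mult_left_mono) auto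
    finally show ?thesis
      by (simp add: z_def)
  qed

  \<comment> \<open>Near the center \<open>mean_bound\<close> degenerates, and compactness replaces it.\<close>
  have "compact (norm_D f ` cball 0 (1/2))"
    by (intro compact_continuous_image continuous_on_subset[OF cont_norm]) auto
  then obtain C where C: "\<And>z. z \<in> cball 0 (1/2) \<Longrightarrow> norm_D f z \<le> C"
    using bounded_real compact_imp_bounded by (metis abs_le_D1 imageI)

  let ?F = "\<lambda>z. complex_of_real (norm_D f z)"
  have cont_F: "continuous_on \<D> ?F"
    by (intro continuous_intros cont_norm)
  have cmod_F: "(\<lambda>\<theta>. cmod (?F (of_real r * cis \<theta>))) = (\<lambda>\<theta>. norm_D f (of_real r * cis \<theta>))" for r
    by (simp add: norm_D_nonneg)
  have int: "set_integrable lebesgue {0..2 * pi} (\<lambda>\<theta>. cmod (?F (of_real r * cis \<theta>)))"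
    if "r \<in> {0<..<1}" for r
    unfolding cmod_F using cont_norm_circle[OF that] by (rule absolutely_integrable_continuous_real)
  have M: "M_1 r ?F = 1 / (2 * pi) * integral {0..2 * pi} (\<lambda>\<theta>. norm_D f (of_real r * cis \<theta>))"
    if "r \<in> {0<..<1}" for r
    using set_lebesgue_integral_eq_integral(2)[OF int[OF that]] unfolding M_1_def cmod_F by simp
  have "M_1 r ?F \<le> max C (K * (2 * B) / pi)" if r: "r \<in> {0<..<1}" for r
  proof (cases "r \<le> 1/2")
    case True
    have "integral {0..2 * pi} (\<lambda>\<theta>. norm_D f (of_real r * cis \<theta>)) \<le> integral {0..2 * pi} (\<lambda>\<theta>. C)"
      using True r C cont_norm_circle[OF r]
      by (intro integral_le integrable_continuous_real) (auto simp: norm_mult)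
    then have "M_1 r ?F \<le> C"
      by (simp add: M[OF r] field_simps)
    then show ?thesis by simp
  next
    case False
    let ?I = "integral {0..2 * pi} (\<lambda>\<theta>. norm_D f (of_real r * cis \<theta>))"
    have "?I \<ge> 0"
      using norm_D_nonneg by (intro integral_nonneg integrable_continuous_real cont_norm_circle r)
    then have "1/2 * ?I \<le> r * ?I"
      using False by (intro mult_right_mono) auto
    then have "?I \<le> 2 * (K * (2 * B))"
      using mean_bound[OF r] by linarith
    then have "M_1 r ?F \<le> K * (2 * B) / pi"
      by (simp add: M[OF r] field_simps)
    then show ?thesis by simp
  qed
  then have "bdd_above ((\<lambda>r. M_1 r ?F) ` {0<..<1})"
    by (intro bdd_aboveI2)
  moreover have "?F \<in> borel_measurable (lebesgue_on \<D>)"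
    using cont_F by (rule continuous_imp_measurable_on_sets_lebesgue) auto
  ultimately show ?thesis
    using int by (simp add: hardy_H1_g_def)
qed

end
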